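(* For the random link $L_n$ in the grid model, $$\lim_{n\to\infty}E\left[\left(\frac{lk(L_n)}{n}\right)^{2}\right]=\frac1{36}.$$
   Context: For a positive integer $n$ and permutations $\sigma,\pi\in S_{2n}$, write $\sigma=(x_1,\dots,x_n,x'_1,\dots,x'_n)$ and $\pi=(y_1,\dots,y_n,y'_1,\dots,y'_n)$ in one-line notation (so $x_k=\sigma(k)$, $x'_l=\sigma(n+l)$, $y_k=\pi(k)$, $y'_l=\pi(n+l)$), the indices $k,l\in\{1,\dots,n\}$ being read modulo $n$. The 2-component oriented grid link diagram $L_n^{\sigma,\pi}$ of order $2n$ has as first component the closed polygonal path $(x_1,y_1)\to(x_1,y_2)\to(x_2,y_2)\to(x_2,y_3)\to\cdots\to(x_n,y_n)\to(x_n,y_1)\to(x_1,y_1)$ and as second component the closed polygonal path $(x'_1,y'_1)\to(x'_1,y'_2)\to(x'_2,y'_2)\to\cdots\to(x'_n,y'_n)\to(x'_n,y'_1)\to(x'_1,y'_1)$; vertical edges always cross over horizontal edges. The linking number of an oriented 2-component link diagram is the sum of the crossing signs over all crossings at which the first component crosses under the second. For $L_n^{\sigma,\pi}$ this is $lk(L_n^{\sigma,\pi})=\sum_{k=1}^n\sum_{l=1}^n\varepsilon_{k,l}^{\sigma,\pi}$, where $\varepsilon_{k,l}^{\sigma,\pi}=+1$ if ($x_k<x'_l<x_{k+1}$ and $y'_{l+1}<y_{k+1}<y'_l$) or ($x_{k+1}<x'_l<x_k$ and $y'_l<y_{k+1}<y'_{l+1}$); $\varepsilon_{k,l}^{\sigma,\pi}=-1$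 if ($x_k<x'_l<x_{k+1}$ and $y'_l<y_{k+1}<y'_{l+1}$) or ($x_{k+1}<x'_l<x_k$ and $y'_{l+1}<y_{k+1}<y'_l$); and $\varepsilon_{k,l}^{\sigma,\pi}=0$ otherwise. The random link $L_n$ in the grid model is $L_n^{\sigma,\pi}$ with $\sigma,\pi\in S_{2n}$ chosen independently and uniformly at random; $lk(L_n)$ is the resulting random variable and $E$ denotes expectation. *)

theory Defs
  imports "HOL-Probability.Probability" "HOL-Combinatorics.Permutations"
begin

text \<open>An oriented edge is a pair (start point, end point) in the integer grid; a component of a
  diagram is the list of its edges in order of traversal; a diagram is a pair of components.\<close>

type_synonym grid_edge = "(int \<times> int) \<times> (int \<times> int)"
type_synonym grid_link_diagram = "grid_edge list \<times> grid_edge list"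

text \<open>The successor of an index in \<open>{1..n}\<close>, read modulo \<open>n\<close>: in particular \<open>n\<close> is followed by \<open>1\<close>.\<close>

definition cyc_suc :: "nat \<Rightarrow> nat \<Rightarrow> nat" where
  "cyc_suc n k = k mod n + 1"

definition grid_component :: "nat \<Rightarrow> (nat \<Rightarrow> int) \<Rightarrow> (nat \<Rightarrow> int) \<Rightarrow> grid_edge list" where
  "grid_component n x y = concat (map (\<lambda>k.
     [((x k, y k), (x k, y (cyc_suc n k))),
      ((x k, y (cyc_suc n k)), (x (cyc_suc n k), y (cyc_suc n k)))]) [1..<Suc n])"

definition grid_link :: "nat \<Rightarrow> (nat \<Rightarrow> nat) \<Rightarrow> (nat \<Rightarrow> nat) \<Rightarrow> grid_link_diagram" where
  "grid_link n \<sigma> \<pi> =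
     (grid_component n (\<lambda>k. int (\<sigma> k)) (\<lambda>k. int (\<pi> k)),
      grid_component n (\<lambda>l. int (\<sigma> (n + l))) (\<lambda>l. int (\<pi> (n + l))))"

text \<open>Since vertical edges always cross over horizontal ones, \<open>e\<close> passes under \<open>f\<close> exactly when
  \<open>e\<close> is horizontal, \<open>f\<close> is vertical and they meet in an interior point of both.\<close>

fun crosses_under :: "grid_edge \<Rightarrow> grid_edge \<Rightarrow> bool" where
  "crosses_under ((a, b), (a', b')) ((c, d), (c', d')) \<longleftrightarrow>
     b = b' \<and> c = c' \<and> min a a' < c \<and> c < max a a' \<and> min d d' < b \<and> b < max d d'"

text \<open>Right-handed sign convention: the sign of the determinant whose columns are the direction of
  the over-strand and the direction of the under-strand, in this order.\<close>

fun crossing_sign :: "grid_edge \<Rightarrow> grid_edge \<Rightarrow> int" where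
  "crossing_sign ((a, b), (a', b')) ((c, d), (c', d')) =
     sgn ((c' - c) * (b' - b) - (d' - d) * (a' - a))"

definition linking_number :: "grid_link_diagram \<Rightarrow> int" where
  "linking_number D = (\<Sum>e \<leftarrow> fst D. \<Sum>f \<leftarrow> snd D. if crosses_under e f then crossing_sign e f else 0)"

definition random_grid_link :: "nat \<Rightarrow> grid_link_diagram pmf" where
  "random_grid_link n = map_pmf (\<lambda>(\<sigma>, \<pi>). grid_link n \<sigma> \<pi>)
     (pair_pmf (pmf_of_set {\<sigma>. \<sigma> permutes {1..2 * n}}) (pmf_of_set {\<pi>. \<pi> permutes {1..2 * n}}))"

text \<open>The combinatorial formula for the linking number in terms of the two permutations.\<close>

definition crossing_eps :: "nat \<Rightarrow> (nat \<Rightarrow> nat) \<Rightarrow> (nat \<Rightarrow> nat) \<Rightarrow> nat \<Rightarrow> nat \<Rightarrow> int" where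
  "crossing_eps n \<sigma> \<pi> k l =
    (let x = \<sigma> k; x\<^sub>1 = \<sigma> (cyc_suc n k); y\<^sub>1 = \<pi> (cyc_suc n k);
         x' = \<sigma> (n + l); y' = \<pi> (n + l); y'\<^sub>1 = \<pi> (n + cyc_suc n l)
     in if (x < x' \<and> x' < x\<^sub>1 \<and> y'\<^sub>1 < y\<^sub>1 \<and> y\<^sub>1 < y') \<or> (x\<^sub>1 < x' \<and> x' < x \<and> y' < y\<^sub>1 \<and> y\<^sub>1 < y'\<^sub>1) then 1
        else if (x < x' \<and> x' < x\<^sub>1 \<and> y' < y\<^sub>1 \<and> y\<^sub>1 < y'\<^sub>1) \<or> (x\<^sub>1 < x' \<and> x' < x \<and> y'\<^sub>1 < y\<^sub>1 \<and> y\<^sub>1 < y') then -1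
        else 0)"

lemma sum_list_grid_component:
  fixes g :: "grid_edge \<Rightarrow> int"
  shows "(\<Sum>e \<leftarrow> grid_component n x y. g e) =
    (\<Sum>k = 1..n. g ((x k, y k), (x k, y (cyc_suc n k)))
      + g ((x k, y (cyc_suc n k)), (x (cyc_suc n k), y (cyc_suc n k))))"
proof -
  have "(\<Sum>e \<leftarrow> concat (map (\<lambda>k. [p k, q k]) ks). g e) = (\<Sum>k \<leftarrow> ks. g (p k) + g (q k))"
    for p q :: "nat \<Rightarrow> grid_edge" and ks
    by (induction ks) auto
  then show ?thesis
    unfolding grid_component_def
    by (simp only: sum_list_distinct_conv_sum_set distinct_upt set_upt atLeastLessThanSuc_atLeastAtMost)
qed

lemma linking_number_grid_link:
  "linking_number (grid_link n \<sigma> \<pi>) = (\<Sum>k = 1..n. \<Sum>l = 1..n. crossing_eps n \<sigma> \<pi> k l)"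
proof -
  define h where "h e f = (if crosses_under e f then crossing_sign e f else 0)" for e f
  have vert: "h ((a, b), (a, b')) f = 0" for a b b' f
    by (cases f) (auto simp: h_def)
  have horiz: "h e ((c, d), (c', d)) = 0" for e c c' d
    by (cases e) (auto simp: h_def)
  have eps: "h ((int (\<sigma> k), int (\<pi> (cyc_suc n k))), (int (\<sigma> (cyc_suc n k)), int (\<pi> (cyc_suc n k))))
      ((int (\<sigma> (n + l)), int (\<pi> (n + l))), (int (\<sigma> (n + l)), int (\<pi> (n + cyc_suc n l))))
      = crossing_eps n \<sigma> \<pi> k l" for k l
    by (auto simp: h_def crossing_eps_def Let_def min_def max_def sgn_if mult_less_0_iff zero_less_mult_iff)
  show ?thesis
    unfolding linking_number_def h_def[symmetric] grid_link_def fst_conv snd_conv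
      sum_list_grid_component vert horiz eps
    by simp
qed

end

theory Submission
  imports Defs
begin

text \<open>The number \<open>4 * crossing_eps n \<sigma> \<pi> k l\<close> is the product of a difference of two order signs of
  \<open>\<sigma>\<close> and a difference of two order signs of \<open>\<pi>\<close>. For a uniform permutation, order signs of
  disjoint pairs are uncorrelated, and those of pairs sharing one endpoint have correlation \<open>1/3\<close>,
  by averaging over the three choices of the common endpoint. The second moment of the linking number
  then factors as the square of a sum over pairs of indices, and equals \<open>n\<^sup>2 / 36\<close> for all \<open>n \<ge> 2\<close>.\<close>

section \<open>Order signs and averages over permutations\<close>

definition order_sgn :: "('a \<Rightarrow> nat) \<Rightarrow> 'a \<Rightarrow> 'a \<Rightarrow> real" where
  "order_sgn \<sigma> i j = sgn (real (\<sigma> j) - real (\<sigma> i))"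

text \<open>For finite \<open>A\<close> this is the expectation under the uniform distribution on
  the permutations of \<open>A\<close>, written as a finite sum so that sums and averages can be
  exchanged without integrability conditions.\<close>

definition perm_avg :: "nat set \<Rightarrow> ((nat \<Rightarrow> nat) \<Rightarrow> real) \<Rightarrow> real" where
  "perm_avg A F = (\<Sum>\<sigma> | \<sigma> permutes A. F \<sigma>) / fact (card A)"

lemma perm_avg_cong:
  assumes "\<And>\<sigma>. \<sigma> permutes A \<Longrightarrow> F \<sigma> = G \<sigma>"
  shows "perm_avg A F = perm_avg A G"
  using assms by (simp add: perm_avg_def)

lemma perm_avg_const:
  assumes "finite A"
  shows "perm_avg A (\<lambda>_. c) = c"
  using assms by (simp add: perm_avg_def card_permutations)

lemma perm_avg_add: "perm_avg A (\<lambda>\<sigma>. F \<sigma> + G \<sigma>) = perm_avg A F + perm_avg A G"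
  by (simp add: perm_avg_def sum.distrib add_divide_distrib)

lemma perm_avg_diff: "perm_avg A (\<lambda>\<sigma>. F \<sigma> - G \<sigma>) = perm_avg A F - perm_avg A G"
  by (simp add: perm_avg_def sum_subtractf diff_divide_distrib)

lemma perm_avg_minus: "perm_avg A (\<lambda>\<sigma>. - F \<sigma>) = - perm_avg A F"
  by (simp add: perm_avg_def sum_negf)

lemma perm_avg_sum: "perm_avg A (\<lambda>\<sigma>. \<Sum>i\<in>I. F i \<sigma>) = (\<Sum>i\<in>I. perm_avg A (F i))"
  unfolding perm_avg_def sum_divide_distrib by (rule sum.swap)

lemma perm_avg_cmult: "perm_avg A (\<lambda>\<sigma>. c * F \<sigma>) = c * perm_avg A F"
  by (simp add: perm_avg_def sum_distrib_left)

lemma perm_avg_cmult_right: "perm_avg A (\<lambda>\<sigma>. F \<sigma> * c) = perm_avg A F * c"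
  by (simp add: perm_avg_def sum_distrib_right)

text \<open>Right multiplication by \<open>\<tau>\<close> is a bijection of the symmetric group, so
  positions may be relabelled under the average. All symmetry arguments below rest on this.\<close>

lemma perm_avg_compose:
  assumes "\<tau> permutes A"
  shows "perm_avg A (\<lambda>\<sigma>. F (\<sigma> \<circ> \<tau>)) = perm_avg A F"
  unfolding perm_avg_def using sum_permutations_compose_right[OF assms, of F] by simp

lemma perm_avg_transpose:
  assumes "i \<in> A" "j \<in> A"
  shows "perm_avg A (\<lambda>\<sigma>. F (\<sigma> \<circ> Transposition.transpose i j)) = perm_avg A F"
  using assms by (intro perm_avg_compose permutes_swap_id)

section \<open>Correlations of order signs\<close>

lemma order_sgn_swap: "order_sgn \<sigma> j i = - order_sgn \<sigma> i j"
  by (simp add: order_sgn_def sgn_if)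

lemma order_sgn_compose: "order_sgn (\<sigma> \<circ> \<tau>) i j = order_sgn \<sigma> (\<tau> i) (\<tau> j)"
  by (simp add: order_sgn_def)

text \<open>The product based at an endpoint is -1 if its value is the middle one of the three, and
  1 if it is the smallest or the largest; hence 1 + 1 - 1.\<close>

lemma order_sgn_common_endpoint_sum:
  assumes "inj \<sigma>" "i \<noteq> j" "i \<noteq> k" "j \<noteq> k"
  shows "order_sgn \<sigma> i j * order_sgn \<sigma> i k + order_sgn \<sigma> j i * order_sgn \<sigma> j k
    + order_sgn \<sigma> k j * order_sgn \<sigma> k i = 1"
proof -
  have "\<sigma> i \<noteq> \<sigma> j" "\<sigma> i \<noteq> \<sigma> k" "\<sigma> j \<noteq> \<sigma> k"
    using assms by (auto dest: injD)
  then show ?thesis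
    by (auto simp: order_sgn_def sgn_if)
qed

text \<open>Transpositions move the common endpoint from \<open>i\<close> to \<open>j\<close> or
  \<open>k\<close>, so the three averages agree, while their sum is 1.\<close>

lemma perm_avg_order_sgn_common_source:
  assumes "finite A" "i \<in> A" "j \<in> A" "k \<in> A" "i \<noteq> j" "i \<noteq> k" "j \<noteq> k"
  shows "perm_avg A (\<lambda>\<sigma>. order_sgn \<sigma> i j * order_sgn \<sigma> i k) = 1 / 3"
proof -
  let ?F = "\<lambda>i j k \<sigma>. order_sgn \<sigma> i j * order_sgn \<sigma> i k"
  have "perm_avg A (?F j i k) = perm_avg A (?F i j k)"
    using perm_avg_transpose[of i A j "?F i j k"] assms by (simp add: order_sgn_compose)
  moreover have "perm_avg A (?F k j i) = perm_avg A (?F i j k)"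
    using perm_avg_transpose[of i A k "?F i j k"] assms by (simp add: order_sgn_compose)
  moreover have "perm_avg A (?F i j k) + perm_avg A (?F j i k) + perm_avg A (?F k j i)
      = perm_avg A (\<lambda>_. 1)"
    unfolding perm_avg_add[symmetric] using assms
    by (intro perm_avg_cong order_sgn_common_endpoint_sum) (auto simp: permutes_inj)
  ultimately show ?thesis
    using assms by (simp add: perm_avg_const)
qed

text \<open>Transposing \<open>i\<close> and \<open>j\<close> flips the first sign and fixes the
  second, so the average equals its own negative.\<close>

lemma perm_avg_order_sgn_disjoint:
  assumes "i \<in> A" "j \<in> A" "{i, j} \<inter> {i', j'} = {}"
  shows "perm_avg A (\<lambda>\<sigma>. order_sgn \<sigma> i j * order_sgn \<sigma> i' j') = 0"
proof -
  have "perm_avg A (\<lambda>\<sigma>. - (order_sgn \<sigma> i j * order_sgn \<sigma> i' j'))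
      = perm_avg A (\<lambda>\<sigma>. order_sgn \<sigma> i j * order_sgn \<sigma> i' j')"
    using perm_avg_transpose[of i A j "\<lambda>\<sigma>. order_sgn \<sigma> i j * order_sgn \<sigma> i' j'"] assms
    by (simp add: order_sgn_compose order_sgn_swap[of _ j i])
  then show ?thesis
    by (simp add: perm_avg_minus)
qed

lemma perm_avg_order_sgn_square:
  assumes "finite A" "i \<noteq> j"
  shows "perm_avg A (\<lambda>\<sigma>. order_sgn \<sigma> i j * order_sgn \<sigma> i j) = 1"
proof -
  have "perm_avg A (\<lambda>\<sigma>. order_sgn \<sigma> i j * order_sgn \<sigma> i j) = perm_avg A (\<lambda>_. 1)"
  proof (rule perm_avg_cong)
    fix \<sigma> assume "\<sigma> permutes A"
    then have "\<sigma> i \<noteq> \<sigma> j"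
      using assms by (auto dest: permutes_inj injD)
    then show "order_sgn \<sigma> i j * order_sgn \<sigma> i j = 1"
      by (auto simp: order_sgn_def sgn_if)
  qed
  then show ?thesis
    using assms by (simp add: perm_avg_const)
qed

text \<open>Sources and targets never coincide, so only \<open>i = i'\<close> and
  \<open>j = j'\<close> can occur. The values 1, 1/3, 1/3, 0 are combined into one polynomial in
  indicators, so that later expansions are pure algebra.\<close>

lemma perm_avg_order_sgn:
  assumes "finite A" "i \<in> A" "j \<in> A" "i' \<in> A" "j' \<in> A"
    and "i \<noteq> j" "i \<noteq> j'" "i' \<noteq> j" "i' \<noteq> j'"
  shows "perm_avg A (\<lambda>\<sigma>. order_sgn \<sigma> i j * order_sgn \<sigma> i' j')
    = (of_bool (i = i') + of_bool (j = j') + of_bool (i = i') * of_bool (j = j')) / 3"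
proof -
  consider "i = i'" "j = j'" | "i = i'" "j \<noteq> j'" | "i \<noteq> i'" "j = j'" | "i \<noteq> i'" "j \<noteq> j'"
    by blast
  then show ?thesis
  proof cases
    case 1
    with assms show ?thesis by (simp add: perm_avg_order_sgn_square)
  next
    case 2
    with assms show ?thesis by (simp add: perm_avg_order_sgn_common_source)
  next
    case 3
    \<comment> \<open>Reversing both pairs makes the common target a common source, and the two
      minus signs cancel.\<close>
    have "(\<lambda>\<sigma>. order_sgn \<sigma> i j * order_sgn \<sigma> i' j) = (\<lambda>\<sigma>. order_sgn \<sigma> j i * order_sgn \<sigma> j i')"
      by (simp add: order_sgn_swap[of _ j])
    with 3 assms show ?thesis by (simp add: perm_avg_order_sgn_common_source)
  next
    case 4
    with assms show ?thesis by (simp add: perm_avg_order_sgn_disjoint)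
  qed
qed

section \<open>The cyclic successor and the Laplacian of the cycle\<close>

lemma cyc_suc_eq_if: "k \<in> {1..n} \<Longrightarrow> cyc_suc n k = (if k = n then 1 else Suc k)"
  by (cases "k = n") (simp_all add: cyc_suc_def)

lemma cyc_suc_in: "k \<in> {1..n} \<Longrightarrow> cyc_suc n k \<in> {1..n}"
  by (simp only: cyc_suc_eq_if) simp

lemma bij_betw_cyc_suc: "bij_betw (cyc_suc n) {1..n} {1..n}"
proof -
  have inj: "inj_on (cyc_suc n) {1..n}"
  proof (rule inj_onI)
    fix k k' assume k: "k \<in> {1..n}" "k' \<in> {1..n}" "cyc_suc n k = cyc_suc n k'"
    from k(3) have "(if k = n then 1 else Suc k) = (if k' = n then 1 else Suc k')"
      unfolding cyc_suc_eq_if[OF k(1)] cyc_suc_eq_if[OF k(2)] .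
    then show "k = k'"
      using k(1,2) by (cases "k = n"; cases "k' = n") simp_all
  qed
  moreover have "cyc_suc n ` {1..n} \<subseteq> {1..n}"
    using cyc_suc_in by blast
  ultimately show ?thesis
    unfolding bij_betw_def using endo_inj_surj[of "{1..n}" "cyc_suc n"] by blast
qed

lemma cyc_suc_eq_iff:
  assumes "k \<in> {1..n}" "k' \<in> {1..n}"
  shows "cyc_suc n k = cyc_suc n k' \<longleftrightarrow> k = k'"
  by (rule inj_on_eq_iff[OF bij_betw_imp_inj_on[OF bij_betw_cyc_suc] assms])

lemma cyc_suc_neq:
  assumes "2 \<le> n" "k \<in> {1..n}"
  shows "cyc_suc n k \<noteq> k"
  using assms(1) unfolding cyc_suc_eq_if[OF assms(2)] by simp

text \<open>The matrix of the Laplacian of the cycle \<open>{1..n}\<close>; inside this range the last summand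
  equals the first, so the diagonal entries are 2 once \<open>n \<ge> 2\<close> (and 0 for \<open>n = 1\<close>).\<close>

definition cyc_laplacian :: "nat \<Rightarrow> nat \<Rightarrow> nat \<Rightarrow> real" where
  "cyc_laplacian n k k' = of_bool (k = k') - of_bool (k = cyc_suc n k')
     - of_bool (cyc_suc n k = k') + of_bool (cyc_suc n k = cyc_suc n k')"

lemma sum_of_bool_cyc_suc:
  assumes "k \<in> {1..n}"
  shows "(\<Sum>k' = 1..n. of_bool (k = cyc_suc n k')) = (1 :: real)"
proof -
  have "(\<Sum>k' = 1..n. of_bool (k = cyc_suc n k')) = (\<Sum>k' = 1..n. of_bool (k = k') :: real)"
    by (rule sum.reindex_bij_betw[OF bij_betw_cyc_suc])
  also have "\<dots> = 1"
    using assms by (simp add: of_bool_def)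
  finally show ?thesis .
qed

text \<open>Each of the four indicators sums to 1 over a row, since \<open>cyc_suc n\<close>
  permutes the indices: 1 - 1 - 1 + 1.\<close>

lemma sum_cyc_laplacian:
  assumes "k \<in> {1..n}"
  shows "(\<Sum>k' = 1..n. cyc_laplacian n k k') = 0"
proof -
  have "cyc_suc n k \<in> {1..n}"
    using assms by (rule cyc_suc_in)
  moreover have "(\<Sum>k' = 1..n. of_bool (j = k')) = (1 :: real)" if "j \<in> {1..n}" for j
    using that by (simp add: of_bool_def)
  ultimately show ?thesis
    using assms unfolding cyc_laplacian_def sum.distrib sum_subtractf
    by (simp only: sum_of_bool_cyc_suc)
qed

text \<open>The constant part of the weight contributes nothing because row sums vanish; what
  remains is the trace, with \<open>n\<close> diagonal entries equal to 2.\<close>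

lemma sum_cyc_laplacian_weighted:
  assumes "2 \<le> n"
  shows "(\<Sum>k = 1..n. \<Sum>k' = 1..n. (1 + of_bool (k = k')) * cyc_laplacian n k k') = 2 * real n"
proof -
  have "(\<Sum>k' = 1..n. (1 + of_bool (k = k')) * cyc_laplacian n k k') = 2" if k: "k \<in> {1..n}" for k
  proof -
    have "(\<Sum>k' = 1..n. (1 + of_bool (k = k')) * cyc_laplacian n k k')
        = (\<Sum>k' = 1..n. cyc_laplacian n k k' + (if k = k' then cyc_laplacian n k k else 0))"
      by (intro sum.cong) auto
    also have "\<dots> = cyc_laplacian n k k"
      unfolding sum.distrib sum_cyc_laplacian[OF k] using k by simp
    \<comment> \<open>Here \<open>2 \<le> n\<close> enters: no index is its own successor, so both
      negative indicators vanish on the diagonal.\<close>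
    also have "\<dots> = 2"
      using cyc_suc_neq[OF assms k] by (auto simp: cyc_laplacian_def)
    finally show ?thesis .
  qed
  then show ?thesis by simp
qed

section \<open>Factoring the crossing sign\<close>

definition source_diff :: "nat \<Rightarrow> (nat \<Rightarrow> nat) \<Rightarrow> nat \<Rightarrow> nat \<Rightarrow> real" where
  "source_diff n \<sigma> k l = order_sgn \<sigma> k (n + l) - order_sgn \<sigma> (cyc_suc n k) (n + l)"

text \<open>The horizontal edge leaving corner \<open>k\<close> of the first component lies at the
  height with index \<open>cyc_suc n k\<close>, hence this source in both signs.\<close>

definition target_diff :: "nat \<Rightarrow> (nat \<Rightarrow> nat) \<Rightarrow> nat \<Rightarrow> nat \<Rightarrow> real" where
  "target_diff n \<pi> k l = order_sgn \<pi> (cyc_suc n k) (n + l) - order_sgn \<pi> (cyc_suc n k) (n + cyc_suc n l)"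

text \<open>By injectivity there are no ties, so each factor is 0 or, when the tested coordinate
  lies strictly between the two others, 2 or -2 according to direction. The 4 removes the two
  factors 2.\<close>

lemma crossing_eps_eq:
  assumes "\<sigma> permutes {1..2 * n}" "\<pi> permutes {1..2 * n}" "k \<in> {1..n}" "l \<in> {1..n}"
  shows "real_of_int (crossing_eps n \<sigma> \<pi> k l) = source_diff n \<sigma> k l * target_diff n \<pi> k l / 4"
proof -
  have "cyc_suc n k \<in> {1..n}" "cyc_suc n l \<in> {1..n}"
    using assms by (simp_all only: cyc_suc_in)
  with assms have "\<sigma> k \<noteq> \<sigma> (n + l)" "\<sigma> (cyc_suc n k) \<noteq> \<sigma> (n + l)"
    "\<pi> (cyc_suc n k) \<noteq> \<pi> (n + l)" "\<pi> (cyc_suc n k) \<noteq> \<pi> (n + cyc_suc n l)"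
    by (auto dest!: permutes_inj injD)
  then have "source_diff n \<sigma> k l = 2 * (of_bool (\<sigma> k < \<sigma> (n + l) \<and> \<sigma> (n + l) < \<sigma> (cyc_suc n k))
        - of_bool (\<sigma> (cyc_suc n k) < \<sigma> (n + l) \<and> \<sigma> (n + l) < \<sigma> k))"
    and "target_diff n \<pi> k l
      = 2 * (of_bool (\<pi> (n + cyc_suc n l) < \<pi> (cyc_suc n k) \<and> \<pi> (cyc_suc n k) < \<pi> (n + l))
        - of_bool (\<pi> (n + l) < \<pi> (cyc_suc n k) \<and> \<pi> (cyc_suc n k) < \<pi> (n + cyc_suc n l)))"
    unfolding source_diff_def target_diff_def order_sgn_def by (simp_all add: sgn_if)
  then show ?thesis
    by (simp only: crossing_eps_def Let_def) (simp add: of_bool_def)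
qed

section \<open>Second moments of the two factors\<close>

lemma perm_avg_order_sgn_halves:
  assumes "i \<in> {1..n}" "i' \<in> {1..n}" "j \<in> {1..n}" "j' \<in> {1..n}"
  shows "perm_avg {1..2 * n} (\<lambda>\<sigma>. order_sgn \<sigma> i (n + j) * order_sgn \<sigma> i' (n + j'))
    = (of_bool (i = i') + of_bool (j = j') + of_bool (i = i') * of_bool (j = j')) / 3"
  using assms by (subst perm_avg_order_sgn) auto

text \<open>Expanding gives four correlations with signs +, -, -, +. The term
  \<open>of_bool (l = l')\<close> standing alone cancels, and the signed indicators in
  \<open>k\<close>, \<open>k'\<close> form the Laplacian.\<close>

lemma perm_avg_source_diff:
  assumes "k \<in> {1..n}" "k' \<in> {1..n}" "l \<in> {1..n}" "l' \<in> {1..n}"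
  shows "perm_avg {1..2 * n} (\<lambda>\<sigma>. source_diff n \<sigma> k l * source_diff n \<sigma> k' l')
    = (1 + of_bool (l = l')) * cyc_laplacian n k k' / 3"
  unfolding source_diff_def right_diff_distrib left_diff_distrib perm_avg_diff
  by (simp only: perm_avg_order_sgn_halves assms cyc_suc_in)
    (simp add: cyc_laplacian_def field_simps split del: split_of_bool)

text \<open>The same expansion with the roles of the components exchanged; injectivity of the
  successor reduces the source indicator to \<open>k = k'\<close>.\<close>

lemma perm_avg_target_diff:
  assumes "k \<in> {1..n}" "k' \<in> {1..n}" "l \<in> {1..n}" "l' \<in> {1..n}"
  shows "perm_avg {1..2 * n} (\<lambda>\<pi>. target_diff n \<pi> k l * target_diff n \<pi> k' l')
    = (1 + of_bool (k = k')) * cyc_laplacian n l l' / 3"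
  unfolding target_diff_def right_diff_distrib left_diff_distrib perm_avg_diff
  by (simp only: perm_avg_order_sgn_halves assms cyc_suc_in cyc_suc_eq_iff[OF assms(1,2)])
    (simp add: cyc_laplacian_def field_simps split del: split_of_bool)

section \<open>The second moment of the linking number\<close>

lemma pair_pmf_of_set:
  fixes A :: "'a set" and B :: "'b set"
  assumes "finite A" "A \<noteq> {}" "finite B" "B \<noteq> {}"
  shows "pair_pmf (pmf_of_set A) (pmf_of_set B) = pmf_of_set (A \<times> B)"
proof (rule pmf_eqI)
  fix p :: "'a \<times> 'b"
  obtain a b where "p = (a, b)" by (cases p)
  moreover have "finite (A \<times> B)" "A \<times> B \<noteq> {}"
    using assms by auto
  ultimately show "pmf (pair_pmf (pmf_of_set A) (pmf_of_set B)) p = pmf (pmf_of_set (A \<times> B)) p"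
    by (simp only: pmf_pair pmf_of_set[OF assms(2,1)] pmf_of_set[OF assms(4,3)] pmf_of_set)
      (simp add: card_cartesian_product indicator_def)
qed

lemma expectation_random_grid_link:
  fixes F :: "grid_link_diagram \<Rightarrow> real"
  shows "measure_pmf.expectation (random_grid_link n) F
    = perm_avg {1..2 * n} (\<lambda>\<sigma>. perm_avg {1..2 * n} (\<lambda>\<pi>. F (grid_link n \<sigma> \<pi>)))"
proof -
  let ?P = "{\<sigma>. \<sigma> permutes {1..2 * n}}"
  have P: "finite ?P" "?P \<noteq> {}" "card ?P = fact (2 * n)"
    using permutes_id[of "{1..2 * n}"] by (auto simp: finite_permutations card_permutations simp del: permutes_id)
  have pair: "pair_pmf (pmf_of_set ?P) (pmf_of_set ?P) = pmf_of_set (?P \<times> ?P)"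
    using P by (intro pair_pmf_of_set)
  have "measure_pmf.expectation (random_grid_link n) F
      = (\<Sum>(\<sigma>, \<pi>) \<in> ?P \<times> ?P. F (grid_link n \<sigma> \<pi>)) / (fact (2 * n) * fact (2 * n))"
    unfolding random_grid_link_def pair integral_map_pmf using P
    by (subst integral_pmf_of_set) (auto simp: card_cartesian_product case_prod_beta)
  also have "\<dots> = perm_avg {1..2 * n} (\<lambda>\<sigma>. perm_avg {1..2 * n} (\<lambda>\<pi>. F (grid_link n \<sigma> \<pi>)))"
    by (simp add: perm_avg_def sum.cartesian_product[symmetric] sum_divide_distrib)
  finally show ?thesis .
qed

lemma expectation_linking_number_square:
  assumes "2 \<le> n"
  shows "measure_pmf.expectation (random_grid_link n) (\<lambda>L. (real_of_int (linking_number L))\<^sup>2)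
    = (real n)\<^sup>2 / 36"
proof -
  let ?A = "{1..2 * n}" and ?I = "{1..n}"
  let ?w = "\<lambda>k k'. (1 + of_bool (k = k')) * cyc_laplacian n k k'"
  have square: "(real_of_int (linking_number (grid_link n \<sigma> \<pi>)))\<^sup>2
      = (\<Sum>k\<in>?I. \<Sum>k'\<in>?I. \<Sum>l\<in>?I. \<Sum>l'\<in>?I.
          source_diff n \<sigma> k l * source_diff n \<sigma> k' l' / 16
            * (target_diff n \<pi> k l * target_diff n \<pi> k' l'))"
    if "\<sigma> permutes ?A" "\<pi> permutes ?A" for \<sigma> \<pi>
  proof -
    have "real_of_int (linking_number (grid_link n \<sigma> \<pi>))
        = (\<Sum>k\<in>?I. \<Sum>l\<in>?I. source_diff n \<sigma> k l * target_diff n \<pi> k l / 4)"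
      unfolding linking_number_grid_link of_int_sum
      using that by (intro sum.cong refl crossing_eps_eq)
    then show ?thesis
      by (simp add: power2_eq_square sum_product mult_ac)
  qed
  have "measure_pmf.expectation (random_grid_link n) (\<lambda>L. (real_of_int (linking_number L))\<^sup>2)
      = perm_avg ?A (\<lambda>\<sigma>. perm_avg ?A (\<lambda>\<pi>. \<Sum>k\<in>?I. \<Sum>k'\<in>?I. \<Sum>l\<in>?I. \<Sum>l'\<in>?I.
          source_diff n \<sigma> k l * source_diff n \<sigma> k' l' / 16
            * (target_diff n \<pi> k l * target_diff n \<pi> k' l')))"
    unfolding expectation_random_grid_link by (intro perm_avg_cong square)
  \<comment> \<open>Independence of \<open>\<sigma>\<close> and \<open>\<pi>\<close>: each summand
    is a product of a factor in one and a factor in the other.\<close>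
  also have "\<dots> = (\<Sum>k\<in>?I. \<Sum>k'\<in>?I. \<Sum>l\<in>?I. \<Sum>l'\<in>?I.
      perm_avg ?A (\<lambda>\<sigma>. source_diff n \<sigma> k l * source_diff n \<sigma> k' l') / 16
        * perm_avg ?A (\<lambda>\<pi>. target_diff n \<pi> k l * target_diff n \<pi> k' l'))"
    by (simp only: perm_avg_sum perm_avg_cmult perm_avg_cmult_right divide_inverse)
  \<comment> \<open>The Laplacian in \<open>k\<close>, \<open>k'\<close> comes from
    \<open>\<sigma>\<close> and its weight from \<open>\<pi>\<close>; for \<open>l\<close>,
    \<open>l'\<close> it is the reverse. Regrouping crosswise separates the variables, with 144 = 16
    * 3 * 3.\<close>
  also have "\<dots> = (\<Sum>k\<in>?I. \<Sum>k'\<in>?I. \<Sum>l\<in>?I. \<Sum>l'\<in>?I. ?w k k' * ?w l l' / 144)"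
    by (intro sum.cong refl) (simp only: perm_avg_source_diff perm_avg_target_diff, simp)
  also have "\<dots> = (\<Sum>k\<in>?I. \<Sum>k'\<in>?I. ?w k k') * (\<Sum>l\<in>?I. \<Sum>l'\<in>?I. ?w l l') / 144"
    by (simp only: sum_distrib_right sum_divide_distrib) (simp only: sum_distrib_left sum_divide_distrib)
  also have "\<dots> = (real n)\<^sup>2 / 36"
    unfolding sum_cyc_laplacian_weighted[OF assms] by (simp add: power2_eq_square)
  finally show ?thesis .
qed

theorem mainTheorem4:
  shows "(\<lambda>n. measure_pmf.expectation (random_grid_link n)
            (\<lambda>L. (real_of_int (linking_number L) / real n)\<^sup>2)) \<longlonglongrightarrow> 1 / 36"
\<comment> \<open>The sequence is constant from \<open>n = 2\<close> on, so eventual equality gives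
  the limit.\<close>
proof (rule tendsto_eventually, rule eventually_sequentiallyI)
  fix n :: nat
  assume "2 \<le> n"
  then show "measure_pmf.expectation (random_grid_link n)
      (\<lambda>L. (real_of_int (linking_number L) / real n)\<^sup>2) = 1 / 36"
    by (simp add: power_divide expectation_linking_number_square)
qed

end
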